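(* Consider a monotone-separable network satisfying (IA) and (AA) (see the context) and the stability condition $\lambda\gamma(0)<1$, and let $\alpha>1$. If $\mathbf{E}[Z_{(-\infty,0]}^{\alpha-1}]$ is finite, then so is $\mathbf{E}Z_0^\alpha$.
   Context: Monotone-separable network. The input $N=\{T_n\}_{n\in\mathbb{Z}}$ is a nondecreasing real sequence of arrival epochs, $\tau_n=T_{n+1}-T_n$, and $\{\zeta_n\}_{n\in\mathbb{Z}}$ is a sequence with values in a measurable space $K$ (service times and routing decisions). There are measurable functions $f_l:\mathbb{R}^l\times K^l\to\mathbb{R}$, $l\ge1$, and for $m\le n$ one puts $X_{[m,n]}(N)=f_{n-m+1}\{(T_l,\zeta_l),\,m\le l\le n\}$ (the finite time of last activity when the network starts empty and is fed by $T_m,\ldots,T_n$). For all inputs $N$ and all $m\le n$ it is required that: (causality) $X_{[m,n]}(N)\ge T_n$; (external monotonicity) $X_{[m,n]}(N')\ge X_{[m,n]}(N)$ whenever $T'_k\ge T_k$ for all $k$; (homogeneity) $X_{[m,n]}(c+N)=X_{[m,n]}(N)+c$ for all $c\in\mathbb{R}$; (separability) for $m\le l<n$, if $X_{[m,l]}(N)\le T_{l+1}$ then $X_{[m,n]}(N)=X_{[l+1,n]}(N)$. Maximal daters: $Z_{[m,n]}(N)=X_{[m,n]}(N)-T_n$; $Z_n=Z_{[n,n]}(N)$ (which does not depend on $N$). The sequence $Z_{[-n,0]}(N)$ is nondecreasing in $n$, and $Z_{(-\infty,0]}=\lim_{n\to\infty}Z_{[-n,0]}(N)$ is the stationary maximal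 dater. Stochastic assumptions: $\{(\tau_n,\zeta_n)\}$ is stationary and ergodic, $\mathbf{E}\tau_n=a=\lambda^{-1}<\infty$, $\mathbf{E}Z_n<\infty$. With $Q$ the degenerate input with all points equal to $0$, $\gamma(0)=\lim_n Z_{[-n,-1]}(Q)/n=\lim_n\mathbf{E}Z_{[-n,-1]}(Q)/n$ a.s. (these limits exist and are constant). (IA): the sequences $\{\zeta_n\}$ and $\{\tau_n\}$ are mutually independent and each consists of i.i.d. random variables. (AA): for all $i$, $Z_i=Y_i^{(1)}+\cdots+Y_i^{(r)}$, where the $Y_i^{(j)}$ are nonnegative, independent of the interarrival times, and the vectors $(Y_i^{(1)},\ldots,Y_i^{(r)})$ are i.i.d. in $i$ (with arbitrary dependence between the components of a vector); in addition, for all $n\le 0$, $Z_{[n,0]}(Q)\ge\max_{j}\sum_{i=n}^0Y_i^{(j)}$ a.s. *)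

theory Defs
  imports "HOL-Probability.Probability"
begin

section \<open>Processes indexed by the integers\<close>

abbreviation path_space :: "'b measure \<Rightarrow> (int \<Rightarrow> 'b) measure" where
  "path_space N \<equiv> PiM (UNIV :: int set) (\<lambda>_. N)"

abbreviation (input) trajectory :: "(int \<Rightarrow> 'w \<Rightarrow> 'b) \<Rightarrow> 'w \<Rightarrow> int \<Rightarrow> 'b" where
  "trajectory X \<equiv> \<lambda>\<omega> n. X n \<omega>"

definition process_law :: "'w measure \<Rightarrow> 'b measure \<Rightarrow> (int \<Rightarrow> 'w \<Rightarrow> 'b) \<Rightarrow> (int \<Rightarrow> 'b) measure" where
  "process_law M N X = distr M (path_space N) (trajectory X)"

definition shift :: "(int \<Rightarrow> 'b) \<Rightarrow> int \<Rightarrow> 'b" where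
  "shift x = (\<lambda>n. x (n + 1))"

definition stationary :: "'w measure \<Rightarrow> 'b measure \<Rightarrow> (int \<Rightarrow> 'w \<Rightarrow> 'b) \<Rightarrow> bool" where
  "stationary M N X \<longleftrightarrow>
     distr (process_law M N X) (path_space N) shift = process_law M N X"

definition ergodic :: "'w measure \<Rightarrow> 'b measure \<Rightarrow> (int \<Rightarrow> 'w \<Rightarrow> 'b) \<Rightarrow> bool" where
  "ergodic M N X \<longleftrightarrow>
     (\<forall>A \<in> sets (path_space N). shift -` A \<inter> space (path_space N) = A \<longrightarrow>
        measure (process_law M N X) A \<in> {0, 1})"

definition iid :: "'w measure \<Rightarrow> 'b measure \<Rightarrow> (int \<Rightarrow> 'w \<Rightarrow> 'b) \<Rightarrow> bool" where
  "iid M N X \<longleftrightarrow>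
     prob_space.indep_vars M (\<lambda>_. N) X UNIV \<and> (\<forall>n. distr M N (X n) = distr M N (X 0))"

text \<open>
  Independence of two random elements with values in measurable spaces over different types;
  \<^const>\<open>prob_space.indep_var\<close> only covers a common type.
\<close>

definition indep_elements ::
    "'w measure \<Rightarrow> 'b measure \<Rightarrow> ('w \<Rightarrow> 'b) \<Rightarrow> 'c measure \<Rightarrow> ('w \<Rightarrow> 'c) \<Rightarrow> bool" where
  "indep_elements M N X L Y \<longleftrightarrow>
     X \<in> measurable M N \<and> Y \<in> measurable M L \<and>
     prob_space.indep_set M {X -` A \<inter> space M | A. A \<in> sets N} {Y -` B \<inter> space M | B. B \<in> sets L}"


section \<open>Monotone-separable networks\<close>

text \<open>
  A point of \<open>\<real>\<^sup>l \<times> K\<^sup>l\<close> is encoded as a function on \<open>{..<l}\<close> with values in \<open>\<real> \<times> K\<close>, and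
  \<open>f l\<close> is the function \<open>f\<^sub>l\<close>. Only intervals with \<open>m \<le> n\<close> are meaningful below.
\<close>

type_synonym 'k network = "nat \<Rightarrow> (nat \<Rightarrow> real \<times> 'k) \<Rightarrow> real"

definition last_activity ::
    "'k network \<Rightarrow> (int \<Rightarrow> 'k) \<Rightarrow> (int \<Rightarrow> real) \<Rightarrow> int \<Rightarrow> int \<Rightarrow> real" where
  "last_activity f z N m n =
     (let l = nat (n - m + 1) in f l (\<lambda>i\<in>{..<l}. (N (m + int i), z (m + int i))))"

definition dater ::
    "'k network \<Rightarrow> (int \<Rightarrow> 'k) \<Rightarrow> (int \<Rightarrow> real) \<Rightarrow> int \<Rightarrow> int \<Rightarrow> real" where
  "dater f z N m n = last_activity f z N m n - N n"

text \<open>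
  The four requirements, for a given sequence \<open>z\<close> of marks and all inputs, i.e. all nondecreasing
  sequences of arrival epochs.
\<close>

definition monotone_separable :: "'k network \<Rightarrow> (int \<Rightarrow> 'k) \<Rightarrow> bool" where
  "monotone_separable f z \<longleftrightarrow>
     (\<forall>N m n. mono N \<longrightarrow> m \<le> n \<longrightarrow> N n \<le> last_activity f z N m n) \<and>
     (\<forall>N N' m n. mono N \<longrightarrow> mono N' \<longrightarrow> m \<le> n \<longrightarrow> (\<forall>k. N k \<le> N' k) \<longrightarrow>
        last_activity f z N m n \<le> last_activity f z N' m n) \<and>
     (\<forall>N m n c. mono N \<longrightarrow> m \<le> n \<longrightarrow>
        last_activity f z (\<lambda>k. c + N k) m n = last_activity f z N m n + c) \<and>
     (\<forall>N m l n. mono N \<longrightarrow> m \<le> l \<longrightarrow> l < n \<longrightarrow> last_activity f z N m l \<le> N (l + 1) \<longrightarrow>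
        last_activity f z N m n = last_activity f z N (l + 1) n)"

definition interarrival :: "(int \<Rightarrow> 'w \<Rightarrow> real) \<Rightarrow> int \<Rightarrow> 'w \<Rightarrow> real" where
  "interarrival T n \<omega> = T (n + 1) \<omega> - T n \<omega>"

definition single_dater ::
    "'k network \<Rightarrow> (int \<Rightarrow> 'w \<Rightarrow> 'k) \<Rightarrow> (int \<Rightarrow> 'w \<Rightarrow> real) \<Rightarrow> int \<Rightarrow> 'w \<Rightarrow> real" where
  "single_dater f \<zeta> T n \<omega> = dater f (trajectory \<zeta> \<omega>) (trajectory T \<omega>) n n"

text \<open>The daters are nonnegative, so \<^const>\<open>ennreal\<close> loses nothing; the limit may be infinite.\<close>

definition stationary_dater ::
    "'k network \<Rightarrow> (int \<Rightarrow> 'w \<Rightarrow> 'k) \<Rightarrow> (int \<Rightarrow> 'w \<Rightarrow> real) \<Rightarrow> 'w \<Rightarrow> ennreal" where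
  "stationary_dater f \<zeta> T \<omega> =
     lim (\<lambda>n::nat. ennreal (dater f (trajectory \<zeta> \<omega>) (trajectory T \<omega>) (- int n) 0))"

text \<open>Power with a positive real exponent on \<open>[0, \<infinity>]\<close>.\<close>

definition ennreal_powr :: "ennreal \<Rightarrow> real \<Rightarrow> ennreal" where
  "ennreal_powr x p = (if x = \<infinity> then \<infinity> else ennreal (enn2real x powr p))"

definition Q_dater :: "'k network \<Rightarrow> (int \<Rightarrow> 'w \<Rightarrow> 'k) \<Rightarrow> int \<Rightarrow> int \<Rightarrow> 'w \<Rightarrow> real" where
  "Q_dater f \<zeta> m n \<omega> = dater f (trajectory \<zeta> \<omega>) (\<lambda>_. 0) m n"

text \<open>
  The degenerate input has all its points at 0. Under the assumptions of a monotone-separable network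
  both limits exist and agree, by subadditivity.
\<close>

definition gamma0 :: "'w measure \<Rightarrow> 'k network \<Rightarrow> (int \<Rightarrow> 'w \<Rightarrow> 'k) \<Rightarrow> real" where
  "gamma0 M f \<zeta> = (THE g.
     (AE \<omega> in M. (\<lambda>n. Q_dater f \<zeta> (- int n) (- 1) \<omega> / real n) \<longlonglongrightarrow> g) \<and>
     (\<lambda>n. (\<integral>\<omega>. Q_dater f \<zeta> (- int n) (- 1) \<omega> \<partial>M) / real n) \<longlonglongrightarrow> g)"

locale monotone_separable_network = prob_space M
  for M :: "'w measure" and K :: "'k measure" and f :: "'k network"
    and T :: "int \<Rightarrow> 'w \<Rightarrow> real" and \<zeta> :: "int \<Rightarrow> 'w \<Rightarrow> 'k" and lam :: real +
  assumes f_measurable: "\<And>l. 1 \<le> l \<Longrightarrow> f l \<in> borel_measurable (PiM {..<l} (\<lambda>_. borel \<Otimes>\<^sub>M K))"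
    and T_measurable: "\<And>n. T n \<in> borel_measurable M"
    and marks_measurable: "\<And>n. \<zeta> n \<in> measurable M K"
    and T_mono: "\<And>\<omega>. \<omega> \<in> space M \<Longrightarrow> mono (trajectory T \<omega>)"
    and monotone_separable: "\<And>\<omega>. \<omega> \<in> space M \<Longrightarrow> monotone_separable f (trajectory \<zeta> \<omega>)"
    and stationary: "stationary M (borel \<Otimes>\<^sub>M K) (\<lambda>n \<omega>. (interarrival T n \<omega>, \<zeta> n \<omega>))"
    and ergodic: "ergodic M (borel \<Otimes>\<^sub>M K) (\<lambda>n \<omega>. (interarrival T n \<omega>, \<zeta> n \<omega>))"
    and lam_pos: "0 < lam"
    and interarrival_integrable: "\<And>n. integrable M (interarrival T n)"
    and interarrival_mean: "\<And>n. expectation (interarrival T n) = 1 / lam"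
    and single_dater_integrable: "\<And>n. integrable M (single_dater f \<zeta> T n)"

definition assumption_IA ::
    "'w measure \<Rightarrow> 'k measure \<Rightarrow> (int \<Rightarrow> 'w \<Rightarrow> real) \<Rightarrow> (int \<Rightarrow> 'w \<Rightarrow> 'k) \<Rightarrow> bool" where
  "assumption_IA M K T \<zeta> \<longleftrightarrow>
     iid M K \<zeta> \<and> iid M borel (interarrival T) \<and>
     indep_elements M (path_space K) (trajectory \<zeta>) (path_space borel) (trajectory (interarrival T))"

text \<open>\<open>Y i j\<close> stands for \<open>Y\<^sub>i\<^sup>(\<^sup>j\<^sup>)\<close>; the vectors live on the index set \<open>{1..r}\<close>.\<close>

definition component_vector ::
    "nat \<Rightarrow> (int \<Rightarrow> nat \<Rightarrow> 'w \<Rightarrow> real) \<Rightarrow> int \<Rightarrow> 'w \<Rightarrow> nat \<Rightarrow> real" where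
  "component_vector r Y i \<omega> = (\<lambda>j\<in>{1..r}. Y i j \<omega>)"

definition assumption_AA ::
    "'w measure \<Rightarrow> 'k network \<Rightarrow> (int \<Rightarrow> 'w \<Rightarrow> real) \<Rightarrow> (int \<Rightarrow> 'w \<Rightarrow> 'k) \<Rightarrow>
     nat \<Rightarrow> (int \<Rightarrow> nat \<Rightarrow> 'w \<Rightarrow> real) \<Rightarrow> bool" where
  "assumption_AA M f T \<zeta> r Y \<longleftrightarrow>
     1 \<le> r \<and>
     (\<forall>i. AE \<omega> in M. single_dater f \<zeta> T i \<omega> = (\<Sum>j=1..r. Y i j \<omega>)) \<and>
     (\<forall>i. \<forall>j\<in>{1..r}. AE \<omega> in M. 0 \<le> Y i j \<omega>) \<and>
     indep_elements M
       (path_space (PiM {1..r} (\<lambda>_. borel))) (trajectory (component_vector r Y))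
       (path_space borel) (trajectory (interarrival T)) \<and>
     iid M (PiM {1..r} (\<lambda>_. borel)) (component_vector r Y) \<and>
     (\<forall>n\<le>0. AE \<omega> in M. (MAX j\<in>{1..r}. \<Sum>i=n..0. Y i j \<omega>) \<le> Q_dater f \<zeta> n 0 \<omega>)"

end

theory Submission
  imports Defs
begin

text \<open>
  Fix a component \<open>j\<close> and let \<open>a = 1/\<lambda>\<close>, \<open>b = 1 + 2a\<close>. Collapsing the input to the single epoch
  \<open>T\<^bsub>-n\<^esub>\<close> gives \<open>Z\<^bsub>(-\<infinity>,0]\<^esub> \<ge> Z\<^bsub>[-n,0]\<^esub>(Q) - (T\<^sub>0 - T\<^bsub>-n\<^esub>) \<ge> Y\<^bsub>-n\<^esub> - (T\<^sub>0 - T\<^bsub>-n\<^esub>)\<close>, so the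
  stationary dater exceeds \<open>N\<close> as soon as \<open>max\<^bsub>n<N\<^esub> Y\<^bsub>-n\<^esub> > bN\<close> and \<open>T\<^sub>0 - T\<^bsub>-N\<^esub> < 2aN\<close>. These two
  events are independent, the second has probability at least \<open>1/2\<close> by Markov's inequality, and the
  first has probability at least \<open>N p / (1 + N p)\<close> with \<open>p = P(Y > bN)\<close>, where \<open>N p\<close> is bounded
  because \<open>Y\<close> is integrable. Hence \<open>N P(Y > bN) \<le> c P(Z > N)\<close>; the extra factor \<open>N\<close> is what raises
  the moment by one, as one sees by summing \<open>N\<^bsup>\<alpha>-1\<^esup>\<close> times this inequality over \<open>N = 2\<^sup>k\<close>.
\<close>

section \<open>Pathwise bounds for the daters\<close>

text \<open>Only the points in the window enter, so an input may be changed freely outside it; the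
  auxiliary inputs \<open>N'\<close> below rely on this.\<close>

lemma last_activity_cong:
  assumes "\<And>k. m \<le> k \<Longrightarrow> k \<le> n \<Longrightarrow> N k = N' k"
  shows "last_activity f z N m n = last_activity f z N' m n"
proof -
  have "(\<lambda>i\<in>{..<nat (n - m + 1)}. (N (m + int i), z (m + int i))) =
        (\<lambda>i\<in>{..<nat (n - m + 1)}. (N' (m + int i), z (m + int i)))"
    by (rule restrict_ext) (auto intro!: assms)
  then show ?thesis
    by (simp add: last_activity_def Let_def)
qed

context
  fixes f :: "'k network" and z :: "int \<Rightarrow> 'k"
  assumes ms: "monotone_separable f z"
begin

lemma last_activity_ge: "mono N \<Longrightarrow> m \<le> n \<Longrightarrow> N n \<le> last_activity f z N m n"
  using ms unfolding monotone_separable_def by blast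

lemma last_activity_mono:
  "mono N \<Longrightarrow> mono N' \<Longrightarrow> m \<le> n \<Longrightarrow> (\<And>k. N k \<le> N' k) \<Longrightarrow>
     last_activity f z N m n \<le> last_activity f z N' m n"
  using ms unfolding monotone_separable_def by blast

lemma last_activity_add:
  "mono N \<Longrightarrow> m \<le> n \<Longrightarrow> last_activity f z (\<lambda>k. c + N k) m n = last_activity f z N m n + c"
  using ms unfolding monotone_separable_def by blast

lemma last_activity_separable:
  "mono N \<Longrightarrow> m \<le> l \<Longrightarrow> l < n \<Longrightarrow> last_activity f z N m l \<le> N (l + 1) \<Longrightarrow>
     last_activity f z N m n = last_activity f z N (l + 1) n"
  using ms unfolding monotone_separable_def by blast

lemma last_activity_const:
  assumes "m \<le> n"
  shows "last_activity f z (\<lambda>_. c) m n = last_activity f z (\<lambda>_. 0) m n + c"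
  using last_activity_add[of "\<lambda>_. 0" m n c] assms by (simp add: mono_def)

lemma dater_nonneg: "mono N \<Longrightarrow> m \<le> n \<Longrightarrow> 0 \<le> dater f z N m n"
  using last_activity_ge[of N m n] by (simp add: dater_def)

text \<open>
  Moving the points before \<open>m\<close> far enough to the left lets the customer \<open>m - 1\<close> leave before the
  arrival of \<open>m\<close>, so that separability applies.
\<close>

lemma last_activity_le_extend:
  assumes N: "mono N" and "m \<le> n"
  shows "last_activity f z N m n \<le> last_activity f z N (m - 1) n"
proof -
  \<comment> \<open>By homogeneity \<open>s\<close> is the time that customer \<open>m - 1\<close>
    alone needs, whatever its arrival epoch. The \<open>min\<close> in \<open>N'\<close> gives room
    \<open>s\<close> before \<open>N m\<close> and keeps \<open>N'\<close> below \<open>N\<close>,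
    so that monotonicity leads back to \<open>N\<close>.\<close>
  define s where "s = last_activity f z (\<lambda>_. 0) (m - 1) (m - 1)"
  define N' where "N' k = (if k < m then min (N k) (N m - s) else N k)" for k
  have N': "mono N'"
  proof (rule monoI)
    fix i k :: int assume "i \<le> k"
    then have "N i \<le> N k" using N by (simp add: monoD)
    then show "N' i \<le> N' k" using \<open>i \<le> k\<close> by (auto simp: N'_def)
  qed
  have "last_activity f z N' (m - 1) (m - 1) = last_activity f z (\<lambda>_. N' (m - 1)) (m - 1) (m - 1)"
    by (rule last_activity_cong) auto
  also have "\<dots> = s + N' (m - 1)"
    unfolding s_def by (rule last_activity_const) simp
  also have "\<dots> \<le> N' (m - 1 + 1)"
    by (simp add: N'_def)
  finally have "last_activity f z N' (m - 1) n = last_activity f z N' (m - 1 + 1) n"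
    using N' assms by (intro last_activity_separable) auto
  also have "\<dots> = last_activity f z N m n"
    by (simp, rule last_activity_cong) (auto simp: N'_def)
  finally show ?thesis
    using last_activity_mono[of N' N "m - 1" n] N' N assms by (auto simp: N'_def)
qed

lemma incseq_dater:
  assumes "mono N"
  shows "incseq (\<lambda>n::nat. dater f z N (- int n) 0)"
proof (rule incseq_SucI)
  fix n :: nat
  have [simp]: "- int (Suc n) = - int n - 1" by simp
  show "dater f z N (- int n) 0 \<le> dater f z N (- int (Suc n)) 0"
    using last_activity_le_extend[OF assms, of "- int n" 0] by (simp add: dater_def del: of_nat_Suc)
qed

text \<open>Monotonicity in \<open>n\<close> makes the sequence converge in \<open>ennreal\<close>,
  so \<open>lim\<close> is its supremum and not an unspecified value.\<close>

lemma dater_le_lim: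
  assumes "mono N"
  shows "ennreal (dater f z N (- int n) 0) \<le> lim (\<lambda>n::nat. ennreal (dater f z N (- int n) 0))"
proof -
  have inc: "incseq (\<lambda>n::nat. ennreal (dater f z N (- int n) 0))"
    using incseq_dater[OF assms] by (auto simp: incseq_def intro: ennreal_leI)
  from limI[OF LIMSEQ_SUP[OF inc]] show ?thesis
    by (metis SUP_upper UNIV_I)
qed

lemma dater_ge_collapsed:
  assumes N: "mono N" and "m \<le> n"
  shows "dater f z (\<lambda>_. 0) m n - (N n - N m) \<le> dater f z N m n"
proof -
  \<comment> \<open>Monotonicity compares inputs at all indices. Truncating at \<open>N m\<close>
    stays below \<open>N\<close> everywhere and is constant from \<open>m\<close> on.\<close>
  define N' where "N' k = min (N k) (N m)" for k
  have N': "mono N'"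
    using N by (auto simp: mono_def N'_def min_def intro: order_trans)
  have "last_activity f z N' m n = last_activity f z (\<lambda>_. N m) m n"
    by (rule last_activity_cong) (use N in \<open>auto simp: N'_def monoD\<close>)
  also have "\<dots> = last_activity f z (\<lambda>_. 0) m n + N m"
    using assms by (intro last_activity_const)
  finally have "last_activity f z (\<lambda>_. 0) m n + N m \<le> last_activity f z N m n"
    using last_activity_mono[of N' N m n] N' N assms by (auto simp: N'_def)
  then show ?thesis by (simp add: dater_def)
qed

end

section \<open>Dyadic comparison of moments\<close>

text \<open>For \<open>y > b\<close> choose \<open>k\<close> with
  \<open>b * 2 ^ k < y \<le> b * 2 ^ Suc k\<close>; the term of this \<open>k\<close> alone
  dominates \<open>y powr \<alpha>\<close>.\<close>

lemma powr_le_dyadic_sum: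
  fixes y b \<alpha> :: real
  assumes "0 \<le> y" "0 < b" "0 < \<alpha>"
  shows "ennreal (y powr \<alpha>) \<le> ennreal (b powr \<alpha>) +
    (\<Sum>k. ennreal ((2 * b) powr \<alpha> * (2 ^ k) powr \<alpha>) * indicator {b * 2 ^ k<..} y)"
proof (cases "y \<le> b")
  case True
  then have "ennreal (y powr \<alpha>) \<le> ennreal (b powr \<alpha>)"
    using assms by (intro ennreal_leI powr_mono2) auto
  then show ?thesis by (rule order_trans) simp
next
  case False
  obtain n0 where "y / b < 2 ^ n0"
    using real_arch_pow[of 2 "y / b"] by auto
  then have ex: "\<exists>n. y \<le> b * 2 ^ n"
    using assms by (intro exI[of _ n0]) (simp add: field_simps)
  define n where "n = (LEAST n. y \<le> b * 2 ^ n)"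
  have n: "y \<le> b * 2 ^ n"
    unfolding n_def using ex by (rule LeastI_ex)
  then obtain k where k: "n = Suc k"
    using False by (cases n) auto
  then have less: "b * 2 ^ k < y"
    using not_less_Least[of k "\<lambda>n. y \<le> b * 2 ^ n"] by (simp add: n_def)
  have "y powr \<alpha> \<le> ((2 * b) * 2 ^ k) powr \<alpha>"
    using n assms by (intro powr_mono2) (auto simp: k mult_ac)
  also have "\<dots> = (2 * b) powr \<alpha> * (2 ^ k) powr \<alpha>"
    using assms by (subst powr_mult) auto
  finally have "ennreal (y powr \<alpha>) \<le>
      ennreal ((2 * b) powr \<alpha> * (2 ^ k) powr \<alpha>) * indicator {b * 2 ^ k<..} y"
    using less by (auto intro!: ennreal_leI)
  also have "\<dots> = (\<Sum>i\<in>{k}. ennreal ((2 * b) powr \<alpha> * (2 ^ i) powr \<alpha>) * indicator {b * 2 ^ i<..} y)"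
    by (subst sum.insert) auto
  also have "\<dots> \<le> (\<Sum>i. ennreal ((2 * b) powr \<alpha> * (2 ^ i) powr \<alpha>) * indicator {b * 2 ^ i<..} y)"
    by (rule sum_le_suminf) auto
  finally show ?thesis
    by (rule order_trans) simp
qed

text \<open>The weight of \<open>k\<close> is the increment of \<open>t powr \<beta>\<close> from
  \<open>t = 2 ^ k / 2\<close> to \<open>t = 2 ^ k\<close>, so the sum over all \<open>2 ^ k\<close>
  below \<open>w\<close> telescopes.\<close>

lemma dyadic_sum_le_powr:
  fixes w :: ennreal and \<beta> :: real
  assumes "0 < \<beta>"
  shows "(\<Sum>k. ennreal ((2 ^ k) powr \<beta> * (1 - 2 powr - \<beta>)) * indicator {ennreal (2 ^ k)<..} w)
    \<le> ennreal_powr w \<beta>"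
proof (cases w)
  case (real x)
  define t where "t k = (2 ^ k) powr \<beta> * (1 - 2 powr - \<beta>) * (if 2 ^ k < x then 1 else 0)" for k :: nat
  have pos: "0 < 1 - 2 powr - \<beta>"
    using powr_less_mono[of "- \<beta>" 0 2] assms by simp
  have t: "0 \<le> t k" for k
    using pos by (simp add: t_def)
  \<comment> \<open>The first bound carries the induction: if \<open>2 ^ n < x\<close>, adding the
    term \<open>t n\<close> turns it into \<open>(2 ^ n) powr \<beta>\<close>, which is at most
    \<open>x powr \<beta>\<close>; otherwise \<open>t n = 0\<close>.\<close>
  have bound: "sum t {..<n} \<le> (2 ^ n) powr \<beta> * 2 powr - \<beta> \<and> sum t {..<n} \<le> x powr \<beta>" for n
  proof (induction n)
    case (Suc n)
    have suc: "(2 ^ Suc n) powr \<beta> * 2 powr - \<beta> = (2 ^ n) powr \<beta>"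
      by (simp add: powr_mult powr_minus field_simps)
    show ?case
    proof (cases "2 ^ n < x")
      case True
      then have "sum t {..<Suc n} \<le> (2 ^ n) powr \<beta>"
        using Suc by (simp add: t_def algebra_simps)
      moreover have "(2 ^ n) powr \<beta> \<le> x powr \<beta>"
        using True assms by (intro powr_mono2) auto
      ultimately show ?thesis
        unfolding suc by linarith
    next
      case False
      then have "sum t {..<Suc n} = sum t {..<n}"
        by (simp add: t_def)
      moreover have "(2 ^ n) powr \<beta> * 2 powr - \<beta> \<le> (2 ^ n) powr \<beta>"
        using mult_left_mono[of "2 powr - \<beta>" 1 "(2 ^ n) powr \<beta>"] pos by simp
      ultimately show ?thesis
        using Suc unfolding suc by linarith
    qed
  qed simp
  have "ennreal ((2 ^ k) powr \<beta> * (1 - 2 powr - \<beta>)) * indicator {ennreal (2 ^ k)<..} w = ennreal (t k)"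
    for k :: nat
    using real by (auto simp: t_def indicator_def ennreal_less_iff)
  then have "(\<Sum>k. ennreal ((2 ^ k) powr \<beta> * (1 - 2 powr - \<beta>)) * indicator {ennreal (2 ^ k)<..} w)
      = (\<Sum>k. ennreal (t k))"
    by simp
  also have "\<dots> \<le> ennreal (x powr \<beta>)"
    using bound t by (intro suminf_le_const) (auto simp: sum_ennreal intro: ennreal_leI)
  finally show ?thesis
    using real by (simp add: ennreal_powr_def)
qed (simp add: ennreal_powr_def)

text \<open>
  The events \<open>E k\<close> replace \<open>{W > 2\<^sup>k}\<close> so that \<open>W\<close> need not be measurable.
\<close>

lemma (in prob_space) moment_transfer:
  fixes Y :: "'a \<Rightarrow> real" and W :: "'a \<Rightarrow> ennreal"
  assumes Y[measurable]: "Y \<in> borel_measurable M" and Y0: "AE \<omega> in M. 0 \<le> Y \<omega>"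
    and "0 < b" "0 \<le> c" "0 < \<beta>"
    and E[measurable]: "\<And>k. E k \<in> events"
    and EW: "\<And>k. AE \<omega> in M. \<omega> \<in> E k \<longrightarrow> ennreal (2 ^ k) < W \<omega>"
    and tail: "\<And>k::nat. 2 ^ k * prob {\<omega> \<in> space M. b * 2 ^ k < Y \<omega>} \<le> c * prob (E k)"
    and W: "(\<integral>\<^sup>+ \<omega>. ennreal_powr (W \<omega>) \<beta> \<partial>M) < \<infinity>"
  shows "(\<integral>\<^sup>+ \<omega>. ennreal (Y \<omega> powr (\<beta> + 1)) \<partial>M) < \<infinity>"
proof -
  define d where "d = 1 - 2 powr - \<beta>"
  have d: "0 < d"
    using powr_less_mono[of "- \<beta>" 0 2] assms by (simp add: d_def)
  define D where "D = (2 * b) powr (\<beta> + 1) * c / d"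
  have D: "0 \<le> D"
    using d assms by (simp add: D_def)
  \<comment> \<open>One factor \<open>2 ^ k\<close> of \<open>(2 ^ k) powr (\<beta> + 1)\<close> is
    absorbed by \<open>tail\<close>, which lowers the exponent to \<open>\<beta>\<close>. The
    division by \<open>d\<close> in \<open>D\<close> produces the weights of
    \<open>dyadic_sum_le_powr\<close>.\<close>
  have term_le: "ennreal ((2 * b) powr (\<beta> + 1) * (2 ^ k) powr (\<beta> + 1)) *
      emeasure M {\<omega> \<in> space M. b * 2 ^ k < Y \<omega>}
    \<le> ennreal D * (ennreal ((2 ^ k) powr \<beta> * d) * emeasure M (E k))" for k :: nat
  proof -
    have "(2 * b) powr (\<beta> + 1) * (2 ^ k) powr (\<beta> + 1) * prob {\<omega> \<in> space M. b * 2 ^ k < Y \<omega>}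
      = (2 * b) powr (\<beta> + 1) * (2 ^ k) powr \<beta> * (2 ^ k * prob {\<omega> \<in> space M. b * 2 ^ k < Y \<omega>})"
      by (simp add: powr_add)
    also have "\<dots> \<le> (2 * b) powr (\<beta> + 1) * (2 ^ k) powr \<beta> * (c * prob (E k))"
      by (intro mult_left_mono tail) auto
    also have "\<dots> = D * ((2 ^ k) powr \<beta> * d * prob (E k))"
      using d by (simp add: D_def)
    finally show ?thesis
      using D d by (simp add: emeasure_eq_measure ennreal_mult[symmetric] ennreal_leI)
  qed
  have events_le: "(\<integral>\<^sup>+ \<omega>. (\<Sum>k. ennreal ((2 ^ k) powr \<beta> * d) * indicator (E k) \<omega>) \<partial>M) \<le>
      (\<integral>\<^sup>+ \<omega>. ennreal_powr (W \<omega>) \<beta> \<partial>M)"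
  proof (rule nn_integral_mono_AE)
    have "AE \<omega> in M. \<forall>k. \<omega> \<in> E k \<longrightarrow> ennreal (2 ^ k) < W \<omega>"
      using EW by (simp add: AE_all_countable)
    then show "AE \<omega> in M. (\<Sum>k. ennreal ((2 ^ k) powr \<beta> * d) * indicator (E k) \<omega>) \<le> ennreal_powr (W \<omega>) \<beta>"
    proof eventually_elim
      case (elim \<omega>)
      have "(\<Sum>k. ennreal ((2 ^ k) powr \<beta> * d) * indicator (E k) \<omega>) \<le>
        (\<Sum>k. ennreal ((2 ^ k) powr \<beta> * (1 - 2 powr - \<beta>)) * indicator {ennreal (2 ^ k)<..} (W \<omega>))"
        using elim by (intro suminf_le) (auto simp: d_def indicator_def)
      also have "\<dots> \<le> ennreal_powr (W \<omega>) \<beta>"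
        using assms by (intro dyadic_sum_le_powr)
      finally show ?case .
    qed
  qed
  have "(\<integral>\<^sup>+ \<omega>. ennreal (Y \<omega> powr (\<beta> + 1)) \<partial>M) \<le>
     (\<integral>\<^sup>+ \<omega>. ennreal (b powr (\<beta> + 1)) +
       (\<Sum>k. ennreal ((2 * b) powr (\<beta> + 1) * (2 ^ k) powr (\<beta> + 1)) *
          indicator {\<omega> \<in> space M. b * 2 ^ k < Y \<omega>} \<omega>) \<partial>M)"
  proof (rule nn_integral_mono_AE)
    show "AE \<omega> in M. ennreal (Y \<omega> powr (\<beta> + 1)) \<le> ennreal (b powr (\<beta> + 1)) +
       (\<Sum>k. ennreal ((2 * b) powr (\<beta> + 1) * (2 ^ k) powr (\<beta> + 1)) *
          indicator {\<omega> \<in> space M. b * 2 ^ k < Y \<omega>} \<omega>)"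
      using Y0 AE_space
    proof eventually_elim
      case (elim \<omega>)
      then show ?case
        using powr_le_dyadic_sum[of "Y \<omega>" b "\<beta> + 1"] assms(3-5) by (simp add: indicator_def)
    qed
  qed
  also have "\<dots> = ennreal (b powr (\<beta> + 1)) +
     (\<Sum>k. ennreal ((2 * b) powr (\<beta> + 1) * (2 ^ k) powr (\<beta> + 1)) *
          emeasure M {\<omega> \<in> space M. b * 2 ^ k < Y \<omega>})"
    by (simp add: nn_integral_add nn_integral_suminf nn_integral_cmult_indicator emeasure_space_1)
  also have "\<dots> \<le> ennreal (b powr (\<beta> + 1)) +
     (\<Sum>k. ennreal D * (ennreal ((2 ^ k) powr \<beta> * d) * emeasure M (E k)))"
    by (intro add_left_mono suminf_le term_le) auto
  also have "(\<Sum>k. ennreal D * (ennreal ((2 ^ k) powr \<beta> * d) * emeasure M (E k))) =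
      ennreal D * (\<integral>\<^sup>+ \<omega>. (\<Sum>k. ennreal ((2 ^ k) powr \<beta> * d) * indicator (E k) \<omega>) \<partial>M)"
    by (simp add: nn_integral_suminf nn_integral_cmult_indicator)
  also have "ennreal (b powr (\<beta> + 1)) + ennreal D *
      (\<integral>\<^sup>+ \<omega>. (\<Sum>k. ennreal ((2 ^ k) powr \<beta> * d) * indicator (E k) \<omega>) \<partial>M)
    \<le> ennreal (b powr (\<beta> + 1)) + ennreal D * (\<integral>\<^sup>+ \<omega>. ennreal_powr (W \<omega>) \<beta> \<partial>M)"
    using events_le by (intro add_left_mono mult_left_mono) auto
  also have "\<dots> < \<infinity>"
    using W by (simp add: ennreal_mult_less_top less_top)
  finally show ?thesis .
qed

section \<open>The tail comparison\<close>

text \<open>The exact probability is \<open>1 - (1 - p) ^ N\<close> with \<open>N = card J\<close>.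
  The ratio is used because it is comparable to \<open>N * p\<close> as long as \<open>N * p\<close>
  stays bounded.\<close>

lemma (in prob_space) prob_Bex_indep_ge:
  fixes X :: "'i \<Rightarrow> 'a \<Rightarrow> real"
  assumes X: "indep_vars (\<lambda>_. borel) X I" and J: "finite J" "J \<subseteq> I"
    and p: "\<And>i. i \<in> J \<Longrightarrow> prob {\<omega> \<in> space M. x < X i \<omega>} = p"
  shows "real (card J) * p / (1 + real (card J) * p) \<le> prob {\<omega> \<in> space M. \<exists>i\<in>J. x < X i \<omega>}"
proof (cases "J = {}")
  case False
  have [measurable]: "X i \<in> borel_measurable M" if "i \<in> J" for i
    using X J that by (auto simp: indep_vars_def)
  define N where "N = card J"
  have p01: "0 \<le> p" "p \<le> 1"
    using False p by (metis all_not_in_conv measure_nonneg, metis all_not_in_conv prob_le_1)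
  have "prob {\<omega> \<in> space M. \<not> (\<exists>i\<in>J. x < X i \<omega>)} = prob (\<Inter>i\<in>J. X i -` {..x} \<inter> space M)"
    using False by (intro arg_cong[where f = prob]) (auto simp: not_less)
  also have "\<dots> = (\<Prod>i\<in>J. prob (X i -` {..x} \<inter> space M))"
    using False J by (intro indep_varsD[OF X]) auto
  also have "\<dots> = (\<Prod>i\<in>J. 1 - p)"
  proof (rule prod.cong)
    fix i assume i: "i \<in> J"
    have "X i -` {..x} \<inter> space M = {\<omega> \<in> space M. \<not> x < X i \<omega>}"
      by (auto simp: not_less)
    also have "prob \<dots> = 1 - prob {\<omega> \<in> space M. x < X i \<omega>}"
      using i by (intro prob_neg) measurable
    finally show "prob (X i -` {..x} \<inter> space M) = 1 - p"
      using p[OF i] by simp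
  qed simp
  also have "\<dots> = (1 - p) ^ N"
    by (simp add: N_def)
  finally have none: "prob {\<omega> \<in> space M. \<not> (\<exists>i\<in>J. x < X i \<omega>)} = (1 - p) ^ N" .
  have "{\<omega> \<in> space M. \<exists>i\<in>J. x < X i \<omega>} \<in> events"
    using J by measurable
  then have some: "prob {\<omega> \<in> space M. \<exists>i\<in>J. x < X i \<omega>} = 1 - (1 - p) ^ N"
    using none prob_neg by force
  \<comment> \<open>Bernoulli's inequality for \<open>1 + p\<close> bounds
    \<open>(1 - p) ^ N\<close> by \<open>1 / (1 + N * p)\<close>.\<close>
  have "(1 - p) ^ N * (1 + real N * p) \<le> (1 - p) ^ N * (1 + p) ^ N"
    using p01 by (intro mult_left_mono Bernoulli_inequality) auto
  also have "\<dots> = (1 - p\<^sup>2) ^ N"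
    by (simp add: power_mult_distrib[symmetric] algebra_simps power2_eq_square)
  also have "\<dots> \<le> 1"
    using p01 by (intro power_le_one) (auto simp: power_le_one)
  finally have "(1 - p) ^ N * (1 + real N * p) \<le> 1" .
  moreover have "0 < 1 + real N * p"
    using p01 by (simp add: add_pos_nonneg)
  ultimately have "real N * p / (1 + real N * p) \<le> 1 - (1 - p) ^ N"
    by (subst pos_divide_le_eq) (auto simp: algebra_simps)
  then show ?thesis
    unfolding some N_def[symmetric] .
qed simp

lemma (in prob_space) indep_elements_prob:
  assumes "indep_elements M N X L Y" "A \<in> sets N" "B \<in> sets L"
  shows "prob ((X -` A \<inter> space M) \<inter> (Y -` B \<inter> space M)) =
    prob (X -` A \<inter> space M) * prob (Y -` B \<inter> space M)"
  using assms unfolding indep_elements_def by (intro indep_setD) auto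

section \<open>Stationary dater and arrival span of a network\<close>

context monotone_separable_network
begin

lemma single_dater_nonneg: "\<omega> \<in> space M \<Longrightarrow> 0 \<le> single_dater f \<zeta> T i \<omega>"
  unfolding single_dater_def
  by (intro dater_nonneg) (auto intro: monotone_separable T_mono)

lemma dater_le_stationary_dater:
  assumes "\<omega> \<in> space M"
  shows "ennreal (dater f (trajectory \<zeta> \<omega>) (trajectory T \<omega>) (- int n) 0) \<le> stationary_dater f \<zeta> T \<omega>"
  unfolding stationary_dater_def
  using assms by (intro dater_le_lim monotone_separable T_mono)

text \<open>Writes the span through interarrival times, whose mean is known and which are the
  variables independent of the components.\<close>

lemma span_eq_sum: "T 0 \<omega> - T (- int N) \<omega> = (\<Sum>i<N. interarrival T (- int N + int i) \<omega>)"
  using sum_lessThan_telescope[of "\<lambda>i. T (- int N + int i) \<omega>" N]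
  by (simp add: interarrival_def add_ac)

text \<open>The span is nonnegative with mean \<open>N / lam\<close>; Markov's inequality is applied
  at twice the mean.\<close>

lemma prob_span_less:
  assumes "0 < N"
  shows "1 / 2 \<le> prob {\<omega> \<in> space M. T 0 \<omega> - T (- int N) \<omega> < 2 / lam * real N}"
proof -
  note T_measurable[measurable]
  define u where "u \<omega> = T 0 \<omega> - T (- int N) \<omega>" for \<omega>
  have u: "u \<omega> = (\<Sum>i<N. interarrival T (- int N + int i) \<omega>)" for \<omega>
    unfolding u_def by (rule span_eq_sum)
  have mean: "expectation u = real N / lam" and int: "integrable M u"
    unfolding u by (auto simp: interarrival_integrable interarrival_mean)
  have "0 \<le> u \<omega>" if "\<omega> \<in> space M" for \<omega>
    using monoD[OF T_mono[OF that], of "- int N" 0] by (simp add: u_def)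
  then have "prob {\<omega> \<in> space M. 2 / lam * real N \<le> u \<omega>} \<le> (real N / lam) / (2 / lam * real N)"
    unfolding mean[symmetric] using assms lam_pos
    by (intro integral_Markov_inequality_measure[OF int sets.empty_sets]) auto
  also have "\<dots> = 1 / 2"
    using assms lam_pos by simp
  finally have "prob {\<omega> \<in> space M. 2 / lam * real N \<le> u \<omega>} \<le> 1 / 2" .
  moreover have "prob {\<omega> \<in> space M. \<not> 2 / lam * real N \<le> u \<omega>} =
      1 - prob {\<omega> \<in> space M. 2 / lam * real N \<le> u \<omega>}"
    unfolding u_def by (intro prob_neg) measurable
  ultimately show ?thesis
    by (simp add: not_le u_def)
qed

section \<open>One fixed component \<open>j\<close> of the single daters\<close>

context
  fixes r :: nat and Y :: "int \<Rightarrow> nat \<Rightarrow> 'w \<Rightarrow> real" and j :: nat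
  assumes AA: "assumption_AA M f T \<zeta> r Y" and j: "j \<in> {1..r}"
begin

lemma component_vector_indep:
  "indep_vars (\<lambda>_. PiM {1..r} (\<lambda>_. borel)) (component_vector r Y) UNIV"
  using AA by (simp add: assumption_AA_def iid_def)

lemma component_indep: "indep_vars (\<lambda>_. borel) (\<lambda>i. Y i j) UNIV"
proof -
  have "indep_vars (\<lambda>_. borel) (\<lambda>i \<omega>. component_vector r Y i \<omega> j) UNIV"
    by (rule indep_vars_compose2[OF component_vector_indep]) (use j in measurable)
  then show ?thesis
    using j by (simp add: component_vector_def)
qed

lemma component_measurable [measurable]: "Y i j \<in> borel_measurable M"
  using component_indep by (auto simp: indep_vars_def)

lemma component_nonneg: "AE \<omega> in M. 0 \<le> Y i j \<omega>"
  using AA j by (simp add: assumption_AA_def)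

lemma component_tail: "prob {\<omega> \<in> space M. x < Y i j \<omega>} = prob {\<omega> \<in> space M. x < Y 0 j \<omega>}"
proof -
  let ?P = "PiM {1..r} (\<lambda>_. borel) :: (nat \<Rightarrow> real) measure"
  have [measurable]: "component_vector r Y i \<in> measurable M ?P" for i
    using component_vector_indep unfolding indep_vars_def by blast
  have [measurable]: "{v \<in> space ?P. x < v j} \<in> sets ?P"
    using j by measurable
  have law: "prob {\<omega> \<in> space M. x < Y i j \<omega>} = measure (distr M ?P (component_vector r Y i)) {v \<in> space ?P. x < v j}"
    for i
    by (subst measure_distr) (measurable, use j in \<open>auto intro!: arg_cong[where f = prob]
      simp: component_vector_def space_PiM PiE_iff\<close>)
  have "distr M ?P (component_vector r Y i) = distr M ?P (component_vector r Y 0)"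
    using AA unfolding assumption_AA_def iid_def by blast
  then show ?thesis
    unfolding law by (rule arg_cong)
qed

text \<open>A nonnegative summand is dominated by the whole sum, the integrable single
  dater.\<close>

lemma component_integrable: "integrable M (Y 0 j)"
proof (rule Bochner_Integration.integrable_bound[OF single_dater_integrable[of 0]])
  have "AE \<omega> in M. \<forall>j\<in>{1..r}. 0 \<le> Y 0 j \<omega>"
    using AA by (subst AE_finite_all) (auto simp: assumption_AA_def)
  moreover have "AE \<omega> in M. single_dater f \<zeta> T 0 \<omega> = (\<Sum>j=1..r. Y 0 j \<omega>)"
    using AA by (simp add: assumption_AA_def)
  ultimately show "AE \<omega> in M. norm (Y 0 j \<omega>) \<le> norm (single_dater f \<zeta> T 0 \<omega>)"
  proof eventually_elim
    case (elim \<omega>)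
    then have "Y 0 j \<omega> \<le> (\<Sum>j=1..r. Y 0 j \<omega>)"
      using j by (intro member_le_sum) auto
    with elim j show ?case by auto
  qed
qed measurable

text \<open>Markov's inequality, after \<open>1 \<le> b\<close> has lowered the threshold to
  \<open>N\<close>. It bounds the denominator \<open>1 + N * p\<close> uniformly in
  \<open>N\<close>.\<close>

lemma component_tail_bound:
  assumes "1 \<le> b" "0 < N"
  shows "real N * prob {\<omega> \<in> space M. b * real N < Y 0 j \<omega>} \<le> expectation (Y 0 j)"
proof -
  have "prob {\<omega> \<in> space M. b * real N < Y 0 j \<omega>} \<le> prob {\<omega> \<in> space M. real N \<le> Y 0 j \<omega>}"
  proof (rule finite_measure_mono)
    have "real N \<le> b * real N"
      using assms by simp
    then show "{\<omega> \<in> space M. b * real N < Y 0 j \<omega>} \<subseteq> {\<omega> \<in> space M. real N \<le> Y 0 j \<omega>}"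
      by auto
  qed measurable
  also have "\<dots> \<le> expectation (Y 0 j) / real N"
    using assms component_nonneg
    by (intro integral_Markov_inequality_measure[OF component_integrable sets.empty_sets]) auto
  finally show ?thesis
    using assms by (simp add: field_simps)
qed

lemma stationary_dater_gt:
  "AE \<omega> in M. \<forall>N::nat. \<forall>i\<in>{- int N<..0}. (1 + 2 / lam) * real N < Y i j \<omega> \<longrightarrow>
     T 0 \<omega> - T (- int N) \<omega> < 2 / lam * real N \<longrightarrow> ennreal (real N) < stationary_dater f \<zeta> T \<omega>"
proof -
  have "AE \<omega> in M. \<forall>i. 0 \<le> Y i j \<omega>"
    by (simp add: AE_all_countable component_nonneg)
  moreover have "AE \<omega> in M. \<forall>n. n \<le> 0 \<longrightarrow> (MAX j\<in>{1..r}. \<Sum>i=n..0. Y i j \<omega>) \<le> Q_dater f \<zeta> n 0 \<omega>"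
    using AA by (auto simp: AE_all_countable assumption_AA_def)
  ultimately show ?thesis
    using AE_space
  proof eventually_elim
    case (elim \<omega>)
    show ?case
    proof (intro allI ballI impI)
      fix N i
      assume i: "i \<in> {- int N<..0}" and Y: "(1 + 2 / lam) * real N < Y i j \<omega>"
        and T: "T 0 \<omega> - T (- int N) \<omega> < 2 / lam * real N"
      have "Y i j \<omega> \<le> (\<Sum>k=i..0. Y k j \<omega>)"
        using elim i by (intro member_le_sum[of i _ "\<lambda>k. Y k j \<omega>"]) auto
      also have "\<dots> \<le> (MAX j\<in>{1..r}. \<Sum>k=i..0. Y k j \<omega>)"
        using j by (intro Max_ge) auto
      also have "\<dots> \<le> Q_dater f \<zeta> i 0 \<omega>"
        using elim i by simp
      also have "\<dots> \<le> dater f (trajectory \<zeta> \<omega>) (trajectory T \<omega>) i 0 + (T 0 \<omega> - T i \<omega>)"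
        using dater_ge_collapsed[OF monotone_separable T_mono, of \<omega> \<omega> i 0] elim i
        by (simp add: Q_dater_def)
      \<comment> \<open>Replacing the span from \<open>i\<close> by the longer one from
        \<open>- N\<close> makes the second condition the same for all \<open>i\<close>.\<close>
      also have "T 0 \<omega> - T i \<omega> \<le> T 0 \<omega> - T (- int N) \<omega>"
        using monoD[OF T_mono, of \<omega> "- int N" i] elim i by simp
      \<comment> \<open>The slope \<open>1 + 2 / lam\<close> is chosen so that exactly
        \<open>N\<close> remains after the span is subtracted.\<close>
      finally have "real N < dater f (trajectory \<zeta> \<omega>) (trajectory T \<omega>) i 0"
        using Y T by (simp add: algebra_simps)
      then have "ennreal (real N) < ennreal (dater f (trajectory \<zeta> \<omega>) (trajectory T \<omega>) i 0)"
        by (intro ennreal_lessI) auto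
      also have "\<dots> \<le> stationary_dater f \<zeta> T \<omega>"
        using dater_le_stationary_dater[of \<omega> "nat (- i)"] elim i by simp
      finally show "ennreal (real N) < stationary_dater f \<zeta> T \<omega>" .
    qed
  qed
qed

text \<open>In the constant, 2 comes from \<open>prob B \<ge> 1 / 2\<close> and
  \<open>1 + expectation (Y 0 j)\<close> bounds the denominator \<open>1 + N * p\<close> in the
  lower bound for \<open>prob A\<close>.\<close>

lemma tail_comparison:
  fixes N :: nat
  assumes "0 < N" "1 \<le> b"
  defines "A \<equiv> {\<omega> \<in> space M. \<exists>i\<in>{- int N<..0}. b * real N < Y i j \<omega>}"
    and "B \<equiv> {\<omega> \<in> space M. T 0 \<omega> - T (- int N) \<omega> < 2 / lam * real N}"
  shows "real N * prob {\<omega> \<in> space M. b * real N < Y 0 j \<omega>} \<le>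
    2 * (1 + expectation (Y 0 j)) * prob (A \<inter> B)"
proof -
  let ?P = "PiM {1..r} (\<lambda>_. borel) :: (nat \<Rightarrow> real) measure"
  define p where "p = prob {\<omega> \<in> space M. b * real N < Y 0 j \<omega>}"
  define C where "C = expectation (Y 0 j)"
  have p: "0 \<le> p" "real N * p \<le> C"
    using component_tail_bound[of b N] assms by (auto simp: p_def C_def)
  have "0 \<le> C"
    unfolding C_def by (rule integral_nonneg_AE[OF component_nonneg])
  have "real N * p / (1 + C) \<le> real N * p / (1 + real N * p)"
    using p \<open>0 \<le> C\<close> by (intro divide_left_mono mult_pos_pos add_pos_nonneg) auto
  also have "\<dots> \<le> prob A"
    \<comment> \<open>The half-open interval has exactly \<open>N\<close> elements.\<close>
    using prob_Bex_indep_ge[OF component_indep, of "{- int N<..0}" "b * real N" p]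
      component_tail[of "b * real N", folded p_def]
    by (simp add: A_def)
  finally have A: "real N * p / (1 + C) \<le> prob A" .
  have B: "1 / 2 \<le> prob B"
    unfolding B_def using assms by (intro prob_span_less)

  \<comment> \<open>Independence is assumed for whole trajectories, so \<open>A\<close> and
    \<open>B\<close> are written as preimages of measurable sets of paths.\<close>
  define A' where "A' = {x \<in> space (path_space ?P). \<exists>i\<in>{- int N<..0}. b * real N < x i j}"
  define B' where "B' = {x \<in> space (path_space (borel :: real measure)).
    (\<Sum>i<N. x (- int N + int i)) < 2 / lam * real N}"
  have [measurable]: "(\<lambda>x. x i j) \<in> borel_measurable (path_space ?P)" for i
    using j by (intro measurable_compose[OF measurable_component_singleton[of i UNIV "\<lambda>_. ?P"]]
        measurable_component_singleton) auto
  have "A' \<in> sets (path_space ?P)"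
    unfolding A'_def by measurable
  moreover have "B' \<in> sets (path_space borel)"
    unfolding B'_def by measurable
  moreover have "indep_elements M (path_space ?P) (trajectory (component_vector r Y))
      (path_space borel) (trajectory (interarrival T))"
    using AA by (simp add: assumption_AA_def)
  moreover have "A = trajectory (component_vector r Y) -` A' \<inter> space M"
    using j by (auto simp: A_def A'_def space_PiM component_vector_def)
  moreover have "B = trajectory (interarrival T) -` B' \<inter> space M"
    by (auto simp: B_def B'_def space_PiM span_eq_sum)
  ultimately have "prob (A \<inter> B) = prob A * prob B"
    by (metis indep_elements_prob)
  moreover have "real N * p / (1 + C) * (1 / 2) \<le> prob A * prob B"
    using A B by (intro mult_mono) auto
  ultimately have "real N * p / (1 + C) / 2 \<le> prob (A \<inter> B)"
    by simp
  then show ?thesis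
    unfolding p_def[symmetric] C_def[symmetric] using \<open>0 \<le> C\<close> by (simp add: field_simps)
qed

lemma component_moment:
  assumes "0 < \<beta>" and "(\<integral>\<^sup>+ \<omega>. ennreal_powr (stationary_dater f \<zeta> T \<omega>) \<beta> \<partial>M) < \<infinity>"
  shows "integrable M (\<lambda>\<omega>. Y 0 j \<omega> powr (\<beta> + 1))"
proof (rule integrableI_nonneg)
  define b where "b = 1 + 2 / lam"
  have b: "1 \<le> b"
    using lam_pos by (simp add: b_def)
  \<comment> \<open>These are the events of \<open>tail_comparison\<close> for
    \<open>N = 2 ^ k\<close>; their intersection forces the stationary dater above
    \<open>2 ^ k\<close>.\<close>
  define A where "A k = {\<omega> \<in> space M. \<exists>i\<in>{- int (2 ^ k)<..0}. b * real (2 ^ k) < Y i j \<omega>}" for k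
  define B where "B k = {\<omega> \<in> space M. T 0 \<omega> - T (- int (2 ^ k)) \<omega> < 2 / lam * real (2 ^ k)}" for k
  note T_measurable[measurable]
  show "(\<integral>\<^sup>+ \<omega>. ennreal (Y 0 j \<omega> powr (\<beta> + 1)) \<partial>M) < \<infinity>"
  proof (rule moment_transfer[where b = b and c = "2 * (1 + expectation (Y 0 j))"
        and E = "\<lambda>k. A k \<inter> B k" and W = "stationary_dater f \<zeta> T"])
    show "A k \<inter> B k \<in> events" for k
      unfolding A_def B_def by measurable
    show "AE \<omega> in M. \<omega> \<in> A k \<inter> B k \<longrightarrow> ennreal (2 ^ k) < stationary_dater f \<zeta> T \<omega>" for k
      using stationary_dater_gt
    proof eventually_elim
      case (elim \<omega>)
      from elim[rule_format, of _ "2 ^ k"] show ?case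
        by (auto simp: A_def B_def b_def)
    qed
    show "2 ^ k * prob {\<omega> \<in> space M. b * 2 ^ k < Y 0 j \<omega>} \<le>
        2 * (1 + expectation (Y 0 j)) * prob (A k \<inter> B k)" for k
      using tail_comparison[of "2 ^ k" b] b by (simp add: A_def B_def)
    show "0 \<le> 2 * (1 + expectation (Y 0 j))"
      using integral_nonneg_AE[OF component_nonneg] by simp
  qed (use assms b component_nonneg in auto)
qed auto

end

end

section \<open>From the components back to the single dater\<close>

theorem theorem2:
  fixes M :: "'w measure" and K :: "'k measure" and f :: "'k network"
    and T :: "int \<Rightarrow> 'w \<Rightarrow> real" and \<zeta> :: "int \<Rightarrow> 'w \<Rightarrow> 'k"
    and lam \<alpha> :: real and r :: nat and Y :: "int \<Rightarrow> nat \<Rightarrow> 'w \<Rightarrow> real"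
  assumes network: "monotone_separable_network M K f T \<zeta> lam"
    and IA: "assumption_IA M K T \<zeta>"
    and AA: "assumption_AA M f T \<zeta> r Y"
    and stable: "lam * gamma0 M f \<zeta> < 1"
    and alpha: "1 < \<alpha>"
    and finite_moment: "(\<integral>\<^sup>+ \<omega>. ennreal_powr (stationary_dater f \<zeta> T \<omega>) (\<alpha> - 1) \<partial>M) < \<infinity>"
  shows "integrable M (\<lambda>\<omega>. single_dater f \<zeta> T 0 \<omega> powr \<alpha>)"
proof -
  interpret monotone_separable_network M K f T \<zeta> lam by (rule network)
  have int: "integrable M (\<lambda>\<omega>. Y 0 j \<omega> powr \<alpha>)" if "j \<in> {1..r}" for j
    using component_moment[OF AA that, of "\<alpha> - 1"] alpha finite_moment by simp
  have "integrable M (\<lambda>\<omega>. real r powr \<alpha> * (\<Sum>j=1..r. Y 0 j \<omega> powr \<alpha>))"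
    by (intro integrable_mult_right Bochner_Integration.integrable_sum int)
  then show ?thesis
  proof (rule Bochner_Integration.integrable_bound)
    have "single_dater f \<zeta> T 0 \<in> borel_measurable M"
      using single_dater_integrable by (rule borel_measurable_integrable)
    then show "(\<lambda>\<omega>. single_dater f \<zeta> T 0 \<omega> powr \<alpha>) \<in> borel_measurable M"
      by measurable
    have "AE \<omega> in M. \<forall>j\<in>{1..r}. 0 \<le> Y 0 j \<omega>"
      using AA by (subst AE_finite_all) (auto simp: assumption_AA_def)
    moreover have "AE \<omega> in M. single_dater f \<zeta> T 0 \<omega> = (\<Sum>j=1..r. Y 0 j \<omega>)"
      using AA by (simp add: assumption_AA_def)
    ultimately show "AE \<omega> in M. norm (single_dater f \<zeta> T 0 \<omega> powr \<alpha>) \<le>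
        norm (real r powr \<alpha> * (\<Sum>j=1..r. Y 0 j \<omega> powr \<alpha>))"
      using AE_space
    proof eventually_elim
      case (elim \<omega>)
      \<comment> \<open>The sum is at most \<open>r\<close> times its largest component, and the
        power of that component is one of the nonnegative terms of the dominating sum.\<close>
      define m where "m = (MAX j\<in>{1..r}. Y 0 j \<omega>)"
      have r: "{1..r} \<noteq> {}"
        using AA by (simp add: assumption_AA_def)
      then have "m \<in> (\<lambda>j. Y 0 j \<omega>) ` {1..r}"
        unfolding m_def by (intro Max_in) auto
      then obtain i where i: "i \<in> {1..r}" "m = Y 0 i \<omega>" by auto
      have "(\<Sum>j=1..r. Y 0 j \<omega>) \<le> (\<Sum>j=1..r. m)"
        by (intro sum_mono) (simp add: m_def)
      then have "single_dater f \<zeta> T 0 \<omega> powr \<alpha> \<le> (real r * m) powr \<alpha>"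
        using elim alpha single_dater_nonneg[of \<omega> 0] by (intro powr_mono2) auto
      also have "\<dots> = real r powr \<alpha> * Y 0 i \<omega> powr \<alpha>"
        using i elim by (simp add: powr_mult)
      also have "\<dots> \<le> real r powr \<alpha> * (\<Sum>j=1..r. Y 0 j \<omega> powr \<alpha>)"
        using i by (intro mult_left_mono member_le_sum) auto
      finally show ?case
        by (simp add: sum_nonneg)
    qed
  qed
qed

end
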